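(* Let $H$ be a countable group and let $p\geq 1$ be any real number. Then there exists a complete separable metric space $(X,\varrho)$ such that the isometry group $\mathrm{Isom}\big(\mathcal{W}_p(X),d_p\big)$ of the $p$-Wasserstein space over $X$ is isomorphic to $H$.
   Context: For a complete separable metric space $(X,\varrho)$ and real $p\geq 1$, $\mathcal{W}_p(X)$ is the set of all Borel probability measures $\mu$ on $X$ with $\int_X\varrho^p(x,\hat x)\,d\mu(x)<\infty$ for some (hence all) $\hat x\in X$, endowed with the metric $d_p(\mu,\nu):=\big(\inf_{\pi\in\Pi(\mu,\nu)}\int_{X\times X}\varrho^p(x,x')\,d\pi(x,x')\big)^{1/p}$, where $\Pi(\mu,\nu)$ is the set of Borel probability measures on $X\times X$ with marginals $\mu$ and $\nu$. An isometry of a metric space is a distance preserving bijection of the space onto itself, and $\mathrm{Isom}(Y,d)$ denotes the group (under composition) of isometries of $(Y,d)$. *)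

theory Defs
  imports "HOL-Analysis.Analysis" "HOL-Probability.Probability_Measure" "HOL-Algebra.Bij"
begin

definition borel_on :: "'a topology \<Rightarrow> 'a measure"
  where "borel_on T = sigma (topspace T) {U. openin T U}"

definition borel_prob :: "'a topology \<Rightarrow> 'a measure set"
  where "borel_prob T = {\<mu>. prob_space \<mu> \<and> sets \<mu> = sets (borel_on T)}"

definition wasserstein_space :: "real \<Rightarrow> 'a metric \<Rightarrow> 'a measure set"
  where "wasserstein_space p X =
    {\<mu> \<in> borel_prob (mtopology_of X).
       \<exists>a \<in> mspace X. (\<integral>\<^sup>+ x. ennreal (mdist X x a powr p) \<partial>\<mu>) < \<infinity>}"

definition couplings :: "'a topology \<Rightarrow> 'a measure \<Rightarrow> 'a measure \<Rightarrow> ('a \<times> 'a) measure set"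
  where "couplings T \<mu> \<nu> =
    {\<pi> \<in> borel_prob (prod_topology T T).
       distr \<pi> (borel_on T) fst = \<mu> \<and> distr \<pi> (borel_on T) snd = \<nu>}"

text \<open>The infimum is taken in the extended nonnegative reals. Between two elements of the
  Wasserstein space it is finite (take the product coupling), so \<^const>\<open>enn2real\<close>
  loses nothing there.\<close>

definition wasserstein_dist :: "real \<Rightarrow> 'a metric \<Rightarrow> 'a measure \<Rightarrow> 'a measure \<Rightarrow> real"
  where "wasserstein_dist p X \<mu> \<nu> =
    enn2real (INF \<pi> \<in> couplings (mtopology_of X) \<mu> \<nu>.
      \<integral>\<^sup>+ (x, y). ennreal (mdist X x y powr p) \<partial>\<pi>) powr (1 / p)"

text \<open>As in \<^const>\<open>BijGroup\<close>, self-maps of \<open>Y\<close> are represented by functions that are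
  \<^const>\<open>undefined\<close> outside \<open>Y\<close>, so that each isometry has exactly one representative.\<close>

definition isometry_group :: "'b set \<Rightarrow> ('b \<Rightarrow> 'b \<Rightarrow> real) \<Rightarrow> ('b \<Rightarrow> 'b) monoid"
  where "isometry_group Y d =
    BijGroup Y \<lparr>carrier := {f \<in> Bij Y. \<forall>x \<in> Y. \<forall>y \<in> Y. d (f x) (f y) = d x y}\<rparr>"

text \<open>A separable metric space has at most continuum many points. A metric space of type
  \<open>real metric\<close> has an arbitrary set of reals as its set of points and an arbitrary metric on
  it, unrelated to the usual one; hence every separable metric space is isometric to a space
  of this type.\<close>

end

theory Submission
  imports Defs "HOL-Probability.Giry_Monad"
begin

text \<open>
On a countable set, take a metric with \<open>\<rho>\<^sup>p = 1 - e\<close> off the diagonal, where \<open>e\<close> is nonnegative and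
symmetric with small row sums. The topology is discrete, so a measure is a summable family of point
masses, and \<open>d\<^sub>p\<^sup>p\<close> is the transport cost with respect to \<open>1 - e\<close>. Isometries for \<open>d\<^sub>p\<close> are the
bijections that preserve this cost, and the exponent disappears from the problem.

Two facts make such a space rigid. The cost attains its maximum 1 exactly between measures all of whose
atoms are pairwise at distance 1, and if the relation \<open>e = 0\<close> separates points, Dirac measures can be
characterised by it (lemma \<open>dirac_iff\<close>). So an isometry permutes the Dirac measures and induces a
permutation \<open>\<sigma>\<close> of the points that preserves \<open>e\<close>. The cost between \<open>\<mu>\<close> and the Dirac measure at \<open>x\<close> is
\<open>1 - \<mu>(x) - \<Sum>\<^sub>y e(x,y) \<mu>(y)\<close>, and the identity plus a contraction of \<open>\<ell>\<^sup>1\<close> is injective; hence these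
costs determine \<open>\<mu>\<close> (lemma \<open>eq_if_cost_dirac_eq\<close>), and the isometry is the push-forward along \<open>\<sigma>\<close>.
Consequently the isometry group of the Wasserstein space is the group of permutations that preserve \<open>e\<close>
(theorem \<open>wasserstein_rigidity\<close>).

It remains to realise a countable group as the symmetry group of such a function \<open>e\<close>, that is, of an
edge-coloured graph with summable positive colours. A Cayley-type graph on four copies of the group
arranged in a cycle does this: its colours \<open>g\<inverse> h\<close> are invariant under left translations and under
nothing else (lemma \<open>aut_is_trans\<close>).
\<close>

section \<open>Almost equilateral countable spaces\<close>

text \<open>The cost \<open>\<rho>\<^sup>p\<close> of the space studied here is \<open>1 - e\<close> off the diagonal, so \<open>e\<close> records how far the
space is from being equilateral. The bound \<open>1/2\<close> on single values gives the triangle inequality for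
every exponent \<open>p \<ge> 1\<close>. The bound on row sums makes \<open>e\<close> a contraction of \<open>\<ell>\<^sup>1\<close>, which is what lets
the distances to Dirac measures determine a measure. The last condition says that the points at
distance exactly 1 from \<open>x\<close> are never all at distance 1 from another point \<open>y\<close>; through it the
Dirac measures can be recognised metrically. In the graph with edges \<open>e x y \<noteq> 0\<close>, it means that
every edge \<open>x y\<close> can be continued beyond \<open>y\<close> to a vertex that is not adjacent to \<open>x\<close>.\<close>

locale near_uniform_space =
  fixes S :: "'a set" and e :: "'a \<Rightarrow> 'a \<Rightarrow> real" and p :: real
  assumes countable_S: "countable S" and S_ne: "S \<noteq> {}" and p_ge: "1 \<le> p"
    and e_sym: "e x y = e y x" and e_refl: "e x x = 0"
    and e_nonneg: "0 \<le> e x y" and e_le: "e x y \<le> 1/2"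
    and e_row: "x \<in> S \<Longrightarrow> (\<integral>\<^sup>+y. ennreal (e x y) \<partial>count_space S) \<le> ennreal (1/2)"
    and separating: "\<lbrakk>x \<in> S; y \<in> S; x \<noteq> y\<rbrakk> \<Longrightarrow>
           \<exists>u\<in>S. u \<noteq> x \<and> e x u = 0 \<and> (u = y \<or> e y u \<noteq> 0)"
begin

definition c :: "'a \<Rightarrow> 'a \<Rightarrow> real"
  where "c x y = (if x = y then 0 else 1 - e x y)"

definition X :: "'a metric"
  where "X = metric (S, \<lambda>x y. c x y powr (1 / p))"

lemma c_refl [simp]: "c x x = 0" by (simp add: c_def)

lemma c_sym: "c x y = c y x" by (simp add: c_def e_sym)

lemma c_nonneg: "0 \<le> c x y" and c_le1: "c x y \<le> 1"
  using e_nonneg[of x y] e_le[of x y] by (auto simp: c_def)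

lemma c_ge_half: "x \<noteq> y \<Longrightarrow> 1/2 \<le> c x y"
  using e_le[of x y] by (auto simp: c_def)

lemma c_root_ge_half: "x \<noteq> y \<Longrightarrow> 1/2 \<le> c x y powr (1 / p)"
proof -
  assume "x \<noteq> y"
  then have c: "1/2 \<le> c x y" by (rule c_ge_half)
  have "(1/2::real) = (1/2) powr 1" by simp
  also have "\<dots> \<le> (1/2) powr (1 / p)"
    using p_ge by (intro powr_mono') auto
  also have "\<dots> \<le> c x y powr (1 / p)"
    using c p_ge by (intro powr_mono2) auto
  finally show ?thesis .
qed

lemma c_root_le1: "c x y powr (1 / p) \<le> 1"
  using c_nonneg[of x y] c_le1[of x y] p_ge by (intro powr_le1) auto

sublocale Met: Metric_space S "\<lambda>x y. c x y powr (1 / p)"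
proof
  fix x y z
  show "c x y powr (1 / p) = c y x powr (1 / p)" by (simp add: c_sym)
  show "c x y powr (1 / p) = 0 \<longleftrightarrow> x = y"
    using c_ge_half[of x y] by (cases "x = y") auto
  show "c x z powr (1 / p) \<le> c x y powr (1 / p) + c y z powr (1 / p)"
  proof (cases "x = y \<or> y = z")
    case False
    then show ?thesis
      using c_root_ge_half[of x y] c_root_ge_half[of y z] c_root_le1[of x z] by auto
  qed auto
qed auto

lemma mspace_X [simp]: "mspace X = S"
  by (simp add: X_def)

lemma mdist_X_powr [simp]: "mdist X x y powr p = c x y"
  using p_ge c_nonneg[of x y] by (simp add: X_def powr_powr)

lemma mtopology_X: "mtopology_of X = discrete_topology S"
proof -
  have "Met.mtopology = discrete_topology S"
  proof -
    have "openin Met.mtopology {x}" if "x \<in> S" for x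
    proof -
      have "y = x" if "y \<in> Met.mball x (1/2)" for y
        using that c_root_ge_half[of x y] by (auto simp: not_less)
      then have "Met.mball x (1/2) = {x}" using that by auto
      then show ?thesis by (metis Met.openin_mball)
    qed
    then show ?thesis
      by (metis discrete_topology_unique Met.topspace_mtopology)
  qed
  then show ?thesis by (simp add: X_def mtopology_of_def)
qed

lemma mcomplete_X: "mcomplete_of X"
proof -
  have "Met.mcomplete"
    unfolding Met.mcomplete_def
  proof (intro allI impI)
    fix s assume s: "Met.MCauchy s"
    then obtain N where N: "\<And>m n. N \<le> m \<Longrightarrow> N \<le> n \<Longrightarrow> c (s m) (s n) powr (1 / p) < 1/2"
      unfolding Met.MCauchy_def by (meson half_gt_zero zero_less_one)
    have eq: "s n = s N" if "N \<le> n" for n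
      using N[OF that order_refl] c_root_ge_half[of "s n" "s N"] by force
    have "s N \<in> S" using s by (auto simp: Met.MCauchy_def)
    moreover have "limitin Met.mtopology s (s N) sequentially"
    proof (rule limitin_transform_eventually)
      show "\<forall>\<^sub>F n in sequentially. s N = s n"
        using eq by (intro eventually_sequentiallyI[of N]) metis
      show "limitin Met.mtopology (\<lambda>_. s N) (s N) sequentially"
        using \<open>s N \<in> S\<close> by simp
    qed
    ultimately show "\<exists>x. limitin Met.mtopology s x sequentially" by blast
  qed
  then show ?thesis by (simp add: X_def mcomplete_of_def)
qed

lemma separable_X: "separable_space (mtopology_of X)"
  unfolding mtopology_X separable_space_def using countable_S
  by (intro exI[of _ S]) (simp add: discrete_topology_closure_of)

section \<open>Borel measures, couplings and the transport cost\<close>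

definition B :: "'a measure" where "B = sigma S (Pow S)"
definition P :: "'a measure set" where "P = {\<mu>. prob_space \<mu> \<and> sets \<mu> = Pow S}"

lemma borel_on_X: "borel_on (mtopology_of X) = B"
  by (simp add: borel_on_def B_def mtopology_X Pow_def openin_discrete_topology[abs_def])

lemma sets_B [simp, measurable_cong]: "sets B = Pow S" 
  unfolding B_def by (simp add: sigma_algebra.sigma_sets_eq[OF sigma_algebra_Pow])
lemma space_B [simp]: "space B = S" unfolding B_def by simp

lemma sets_borel_prod_X:
  "sets (borel_on (prod_topology (mtopology_of X) (mtopology_of X))) = Pow (S \<times> S)"
proof -
  have "prod_topology (mtopology_of X) (mtopology_of X) = discrete_topology (S \<times> S)"
    unfolding mtopology_X by (metis prod_topology_discrete_topology)
  then have "{U. openin (prod_topology (mtopology_of X) (mtopology_of X)) U} = Pow (S \<times> S)"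
    "topspace (prod_topology (mtopology_of X) (mtopology_of X)) = S \<times> S"
     by auto
  then show ?thesis unfolding borel_on_def 
    by (simp add: sigma_algebra.sigma_sets_eq[OF sigma_algebra_Pow])
qed

lemma P_D: assumes "\<mu> \<in> P" shows "prob_space \<mu>" "sets \<mu> = Pow S" "space \<mu> = S"
  using assms sets_eq_imp_space_eq[of \<mu> B] by (auto simp: P_def)

lemma wasserstein_space_X: "wasserstein_space p X = P"
proof -
  have "(\<integral>\<^sup>+ x. ennreal (mdist X x a powr p) \<partial>\<mu>) < \<infinity>" if "\<mu> \<in> P" for \<mu> a
  proof -
    interpret prob_space \<mu> using that by (rule P_D)
    have "(\<integral>\<^sup>+ x. ennreal (mdist X x a powr p) \<partial>\<mu>) \<le> (\<integral>\<^sup>+ x. 1 \<partial>\<mu>)"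
      by (intro nn_integral_mono) (simp add: c_le1)
    also have "\<dots> = 1" by (simp add: emeasure_space_1)
    finally show ?thesis by (rule le_less_trans) simp
  qed
  then show ?thesis
    using S_ne unfolding wasserstein_space_def borel_prob_def borel_on_X P_def by auto
qed

lemma couplings_X: "\<pi> \<in> couplings (mtopology_of X) \<mu> \<nu> \<longleftrightarrow>
    prob_space \<pi> \<and> sets \<pi> = Pow (S \<times> S) \<and> distr \<pi> B fst = \<mu> \<and> distr \<pi> B snd = \<nu>"
  unfolding couplings_def borel_prob_def sets_borel_prod_X borel_on_X by auto

text \<open>The \<open>p\<close>-th power of the Wasserstein distance. It is as good as the distance for recognising
isometries, and the exponent \<open>p\<close> no longer occurs in it.\<close>

definition cost :: "'a measure \<Rightarrow> 'a measure \<Rightarrow> ennreal"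
  where "cost \<mu> \<nu> = (INF \<pi> \<in> couplings (mtopology_of X) \<mu> \<nu>. \<integral>\<^sup>+ z. ennreal (c (fst z) (snd z)) \<partial>\<pi>)"

lemma wasserstein_dist_X: "wasserstein_dist p X \<mu> \<nu> = enn2real (cost \<mu> \<nu>) powr (1 / p)"
  unfolding wasserstein_dist_def cost_def by (simp add: case_prod_unfold)

lemma pairs_measurable:
  assumes "sets \<pi> = Pow (S \<times> S)" and "g ` (S \<times> S) \<subseteq> space N" shows "g \<in> measurable \<pi> N"
proof -
  have s: "sets \<pi> = sets (count_space (S \<times> S))" using assms by simp
  show ?thesis unfolding measurable_cong_sets[OF s refl] using assms(2) by auto
qed

lemma P_measurable:
  assumes "sets \<mu> = Pow S" and "g ` S \<subseteq> space N" shows "g \<in> measurable \<mu> N"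
proof -
  have s: "sets \<mu> = sets (count_space S)" using assms by simp
  show ?thesis unfolding measurable_cong_sets[OF s refl] using assms(2) by auto
qed

lemma prod_coupling:
  assumes "\<mu> \<in> P" "\<nu> \<in> P" shows "\<mu> \<Otimes>\<^sub>M \<nu> \<in> couplings (mtopology_of X) \<mu> \<nu>"
proof -
  note [measurable_cong] = P_D(2)[OF assms(1)] P_D(2)[OF assms(2)]
  interpret M: prob_space \<mu> using assms by (blast dest: P_D)
  interpret N: prob_space \<nu> using assms by (blast dest: P_D)
  interpret MN: pair_prob_space \<mu> \<nu> ..
  have "sets (\<mu> \<Otimes>\<^sub>M \<nu>) = sets (count_space S \<Otimes>\<^sub>M count_space S)"
    using P_D[OF assms(1)] P_D[OF assms(2)] by (intro sets_pair_measure_cong) auto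
  also have "\<dots> = Pow (S \<times> S)"
    by (subst pair_measure_countable) (auto simp: countable_S)
  finally have s: "sets (\<mu> \<Otimes>\<^sub>M \<nu>) = Pow (S \<times> S)" .
  have "distr (\<mu> \<Otimes>\<^sub>M \<nu>) B fst = distr (\<mu> \<Otimes>\<^sub>M \<nu>) \<mu> fst"
    using P_D[OF assms(1)] by (intro distr_cong) auto
  also have "\<dots> = \<mu>" by (rule N.distr_pair_fst)
  finally have f: "distr (\<mu> \<Otimes>\<^sub>M \<nu>) B fst = \<mu>" .
  have "distr (\<mu> \<Otimes>\<^sub>M \<nu>) B snd = \<nu>"
  proof (rule measure_eqI)
    show "sets (distr (\<mu> \<Otimes>\<^sub>M \<nu>) B snd) = sets \<nu>" using P_D[OF assms(2)] by simp
    fix A assume "A \<in> sets (distr (\<mu> \<Otimes>\<^sub>M \<nu>) B snd)"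
    then have A: "A \<in> Pow S" by simp
    have "emeasure (distr (\<mu> \<Otimes>\<^sub>M \<nu>) B snd) A = emeasure (\<mu> \<Otimes>\<^sub>M \<nu>) (space \<mu> \<times> A)"
      using A P_D(3)[OF assms(1)] P_D(3)[OF assms(2)]
      by (subst emeasure_distr[OF pairs_measurable[OF s]])
         (auto simp: space_pair_measure intro!: arg_cong[where f="emeasure _"])
    also have "\<dots> = emeasure \<nu> A"
      using A P_D[OF assms(2)] by (subst N.emeasure_pair_measure_Times) (auto simp: M.emeasure_space_1)
    finally show "emeasure (distr (\<mu> \<Otimes>\<^sub>M \<nu>) B snd) A = emeasure \<nu> A" .
  qed
  then show ?thesis unfolding couplings_X using s f MN.prob_space_axioms by blast
qed

lemma coupling_integral_le1:
  assumes "\<pi> \<in> couplings (mtopology_of X) \<mu> \<nu>" 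
  shows "(\<integral>\<^sup>+ z. ennreal (c (fst z) (snd z)) \<partial>\<pi>) \<le> 1"
proof -
  interpret prob_space \<pi> using assms unfolding couplings_X by simp
  have "(\<integral>\<^sup>+ z. ennreal (c (fst z) (snd z)) \<partial>\<pi>) \<le> (\<integral>\<^sup>+ z. 1 \<partial>\<pi>)"
    by (intro nn_integral_mono) (simp add: c_le1)
  then show ?thesis by (simp add: emeasure_space_1)
qed

lemma cost_le1: "\<mu> \<in> P \<Longrightarrow> \<nu> \<in> P \<Longrightarrow> cost \<mu> \<nu> \<le> 1"
  unfolding cost_def by (rule INF_lower2[OF prod_coupling]) (auto intro: coupling_integral_le1 prod_coupling)

lemma cost_eq_dist: assumes "\<mu> \<in> P" "\<nu> \<in> P" 
  shows "cost \<mu> \<nu> = ennreal (wasserstein_dist p X \<mu> \<nu> powr p)"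
proof -
  have "cost \<mu> \<nu> < \<infinity>"
    using cost_le1[OF assms] by (rule le_less_trans) simp
  then show ?thesis using p_ge unfolding wasserstein_dist_X by (simp add: powr_powr infinity_ennreal_def)
qed

lemma cost_eq_iff:
  assumes "\<mu> \<in> P" "\<nu> \<in> P" "\<mu>' \<in> P" "\<nu>' \<in> P"
  shows "wasserstein_dist p X \<mu> \<nu> = wasserstein_dist p X \<mu>' \<nu>' \<longleftrightarrow> cost \<mu> \<nu> = cost \<mu>' \<nu>'"
  using assms by (metis cost_eq_dist wasserstein_dist_X)

abbreviation dirac :: "'a \<Rightarrow> 'a measure" where "dirac \<equiv> return B"

lemma dirac_P: "x \<in> S \<Longrightarrow> dirac x \<in> P"
  unfolding P_def by (auto intro!: prob_space_return)

lemma emeasure_dirac: "x \<in> S \<Longrightarrow> y \<in> S \<Longrightarrow> emeasure (dirac x) {y} = (if x = y then 1 else 0)"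
  by (simp add: indicator_def)

lemma P_eqI:
  assumes "\<mu> \<in> P" "\<nu> \<in> P" "\<And>x. x \<in> S \<Longrightarrow> emeasure \<mu> {x} = emeasure \<nu> {x}" shows "\<mu> = \<nu>"
  by (rule measure_eqI_countable[OF P_D(2)[OF assms(1)] P_D(2)[OF assms(2)] countable_S assms(3)])

text \<open>Integration against a measure on a countable discrete space is summation against its point masses;
stated with the counting measure, so that Fubini's theorem applies to it.\<close>

lemma P_nn_integral:
  assumes "\<mu> \<in> P"
  shows "(\<integral>\<^sup>+x. f x \<partial>\<mu>) = (\<integral>\<^sup>+x. emeasure \<mu> {x} * f x \<partial>count_space S)"
proof -
  have "\<mu> = density (count_space S) (\<lambda>x. emeasure \<mu> {x})"
    using P_D[OF assms] countable_S
    by (intro measure_eqI_countable[of _ S]) (auto simp: emeasure_density nn_integral_count_space_indicator[symmetric])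
  then have "(\<integral>\<^sup>+x. f x \<partial>\<mu>) = (\<integral>\<^sup>+x. f x \<partial>density (count_space S) (\<lambda>x. emeasure \<mu> {x}))"
    by simp
  also have "\<dots> = (\<integral>\<^sup>+x. emeasure \<mu> {x} * f x \<partial>count_space S)"
    by (subst nn_integral_density) auto
  finally show ?thesis .
qed

lemma P_mass: "\<mu> \<in> P \<Longrightarrow> (\<integral>\<^sup>+x. emeasure \<mu> {x} \<partial>count_space S) = 1"
  using P_nn_integral[of \<mu> "\<lambda>_. 1"] P_D[of \<mu>] prob_space.emeasure_space_1[of \<mu>] by simp

text \<open>A Dirac measure admits only one coupling with a given measure, so no minimisation is left.\<close>

lemma cost_dirac:
  assumes "\<mu> \<in> P" "x \<in> S"
  shows "cost \<mu> (dirac x) = (\<integral>\<^sup>+y. ennreal (c y x) \<partial>\<mu>)"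
proof -
  have "(\<integral>\<^sup>+ z. ennreal (c (fst z) (snd z)) \<partial>\<pi>) = (\<integral>\<^sup>+y. ennreal (c y x) \<partial>\<mu>)"
    if \<pi>: "\<pi> \<in> couplings (mtopology_of X) \<mu> (dirac x)" for \<pi>
  proof -
    have s: "sets \<pi> = Pow (S \<times> S)" and m: "distr \<pi> B fst = \<mu>" "distr \<pi> B snd = dirac x" using \<pi> unfolding couplings_X by auto
    have [measurable]: "fst \<in> measurable \<pi> B" "snd \<in> measurable \<pi> B"
      by (auto intro!: pairs_measurable[OF s])
    have [measurable]: "Measurable.pred B (\<lambda>y. y = x)"
      using assms(2) by (auto simp: pred_def)
    have [measurable]: "(\<lambda>y. ennreal (c y x)) \<in> borel_measurable B"
      by (auto intro!: P_measurable)
    have "AE y in dirac x. y = x" using assms(2) by (subst AE_return) auto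
    then have "AE z in \<pi>. snd z = x" unfolding m(2)[symmetric] by (subst (asm) AE_distr_iff) auto
    then have "(\<integral>\<^sup>+ z. ennreal (c (fst z) (snd z)) \<partial>\<pi>) = (\<integral>\<^sup>+ z. ennreal (c (fst z) x) \<partial>\<pi>)"
      by (intro nn_integral_cong_AE) auto
    also have "\<dots> = (\<integral>\<^sup>+y. ennreal (c y x) \<partial>\<mu>)"
      unfolding m(1)[symmetric] by (subst nn_integral_distr) auto
    finally show ?thesis .
  qed
  moreover have "couplings (mtopology_of X) \<mu> (dirac x) \<noteq> {}"
    using prod_coupling[OF assms(1) dirac_P[OF assms(2)]] by blast
  ultimately show ?thesis unfolding cost_def by simp
qed

lemma cost_dirac_dirac: "x \<in> S \<Longrightarrow> y \<in> S \<Longrightarrow> cost (dirac x) (dirac y) = ennreal (c x y)"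
  using nn_integral_return[of x B "\<lambda>z. ennreal (c z y)"]
  by (simp add: cost_dirac dirac_P P_measurable)

section \<open>Metric recognition of Dirac measures\<close>

definition supp :: "'a measure \<Rightarrow> 'a set"
  where "supp \<mu> = {x\<in>S. emeasure \<mu> {x} \<noteq> 0}"

lemma AE_supp:
  assumes "\<mu> \<in> P" shows "AE x in \<mu>. x \<in> supp \<mu>"
proof -
  have "emeasure \<mu> (S - supp \<mu>) = (\<integral>\<^sup>+x. indicator (S - supp \<mu>) x \<partial>\<mu>)"
    using P_D[OF assms] by simp
  also have "\<dots> = (\<integral>\<^sup>+x. 0 \<partial>count_space S)"
    unfolding P_nn_integral[OF assms]
    by (intro nn_integral_cong) (auto simp: supp_def indicator_def)
  finally have "emeasure \<mu> (S - supp \<mu>) = 0" by simp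
  then show ?thesis
    using P_D[OF assms] by (subst AE_iff_measurable[of "S - supp \<mu>"]) (auto simp: supp_def)
qed

lemma supp_ne: assumes "\<mu> \<in> P" shows "supp \<mu> \<noteq> {}"
proof
  assume "supp \<mu> = {}"
  then have "AE x in \<mu>. False" using AE_supp[OF assms] by simp
  then show False using prob_space.AE_False P_D(1)[OF assms] by blast
qed

lemma supp_dirac: "x \<in> S \<Longrightarrow> supp (dirac x) = {x}"
  by (auto simp: supp_def emeasure_dirac simp del: emeasure_return split: if_splits)

lemma eq_dirac_if_supp:
  assumes "\<mu> \<in> P" "x \<in> S" "supp \<mu> \<subseteq> {x}" shows "\<mu> = dirac x"
proof (rule P_eqI[OF assms(1) dirac_P[OF assms(2)]])
  interpret prob_space \<mu> using assms(1) by (rule P_D)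
  fix y assume y: "y \<in> S"
  have "AE z in \<mu>. z \<in> {x}" using AE_supp[OF assms(1)] assms(3) by auto
  then have "emeasure \<mu> {x} = 1"
    using P_D(2)[OF assms(1)] assms(2) by (subst emeasure_eq_1_AE) auto
  then show "emeasure \<mu> {y} = emeasure (dirac x) {y}"
    using assms y by (auto simp: emeasure_dirac supp_def simp del: emeasure_return)
qed

text \<open>The value 1 is the largest possible cost. The product coupling charges every pair of atoms, so it
already beats 1 as soon as one such pair is closer than 1; conversely, every coupling lives on pairs
from the two supports.\<close>

lemma cost_eq_1_iff:
  assumes \<mu>: "\<mu> \<in> P" and \<nu>: "\<nu> \<in> P"
  shows "cost \<mu> \<nu> = 1 \<longleftrightarrow> (\<forall>x\<in>supp \<mu>. \<forall>y\<in>supp \<nu>. x \<noteq> y \<and> e x y = 0)"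
proof
  assume far: "\<forall>x\<in>supp \<mu>. \<forall>y\<in>supp \<nu>. x \<noteq> y \<and> e x y = 0"
  have "(\<integral>\<^sup>+ z. ennreal (c (fst z) (snd z)) \<partial>\<pi>) = 1"
    if \<pi>: "\<pi> \<in> couplings (mtopology_of X) \<mu> \<nu>" for \<pi>
  proof -
    have s: "sets \<pi> = Pow (S \<times> S)" and m: "distr \<pi> B fst = \<mu>" "distr \<pi> B snd = \<nu>"
      and pr: "prob_space \<pi>"
      using \<pi> unfolding couplings_X by auto
    interpret prob_space \<pi> by (rule pr)
    have f: "fst \<in> measurable \<pi> B" "snd \<in> measurable \<pi> B"
      by (auto intro!: pairs_measurable[OF s])
    have "AE z in \<pi>. fst z \<in> supp \<mu>" 
      by (rule AE_distrD[OF f(1)]) (unfold m, rule AE_supp[OF \<mu>])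
    moreover have "AE z in \<pi>. snd z \<in> supp \<nu>"
      by (rule AE_distrD[OF f(2)]) (unfold m, rule AE_supp[OF \<nu>])
    ultimately have "AE z in \<pi>. ennreal (c (fst z) (snd z)) = 1"
      by eventually_elim (use far in \<open>simp add: c_def\<close>)
    then have "(\<integral>\<^sup>+ z. ennreal (c (fst z) (snd z)) \<partial>\<pi>) = (\<integral>\<^sup>+ z. 1 \<partial>\<pi>)"
      by (rule nn_integral_cong_AE)
    then show ?thesis by (simp add: emeasure_space_1)
  qed
  moreover have "couplings (mtopology_of X) \<mu> \<nu> \<noteq> {}"
    using prod_coupling[OF assms] by blast
  ultimately show "cost \<mu> \<nu> = 1" unfolding cost_def by simp
next
  assume one: "cost \<mu> \<nu> = 1"
  let ?\<pi> = "\<mu> \<Otimes>\<^sub>M \<nu>"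
  have cpl: "?\<pi> \<in> couplings (mtopology_of X) \<mu> \<nu>" by (rule prod_coupling[OF assms])
  have s: "sets ?\<pi> = Pow (S \<times> S)" using cpl unfolding couplings_X by simp
  interpret pr: prob_space ?\<pi> using cpl unfolding couplings_X by simp
  interpret N: prob_space \<nu> using \<nu> by (rule P_D)
  let ?I = "\<integral>\<^sup>+ z. ennreal (c (fst z) (snd z)) \<partial>?\<pi>"
  let ?J = "\<integral>\<^sup>+ z. ennreal (1 - c (fst z) (snd z)) \<partial>?\<pi>"
  have "?I + ?J = (\<integral>\<^sup>+ z. ennreal (c (fst z) (snd z)) + ennreal (1 - c (fst z) (snd z)) \<partial>?\<pi>)"
    by (rule nn_integral_add[symmetric]) (auto intro!: pairs_measurable[OF s])
  also have "\<dots> = (\<integral>\<^sup>+ z. 1 \<partial>?\<pi>)"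
    by (intro nn_integral_cong)
       (simp add: ennreal_plus[symmetric] c_nonneg c_le1 del: ennreal_plus)
  finally have IJ: "?I + ?J = 1" by (simp add: pr.emeasure_space_1)
  have "1 \<le> ?I" using one cpl unfolding cost_def by (metis (no_types, lifting) INF_lower)
  then have I: "?I = 1" using coupling_integral_le1[OF cpl] by (rule antisym[rotated])
  then have J: "?J = 0" using IJ ennreal_add_left_cancel[of 1 ?J 0] by simp
  show "\<forall>x\<in>supp \<mu>. \<forall>y\<in>supp \<nu>. x \<noteq> y \<and> e x y = 0"
  proof (intro ballI)
    fix x y assume x: "x \<in> supp \<mu>" and y: "y \<in> supp \<nu>"
    have "emeasure ?\<pi> ({x} \<times> {y}) = emeasure \<mu> {x} * emeasure \<nu> {y}"
      using x y P_D(2)[OF \<mu>] P_D(2)[OF \<nu>]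
      by (intro N.emeasure_pair_measure_Times) (auto simp: supp_def)
    then have pos: "emeasure ?\<pi> {(x, y)} \<noteq> 0"
      using x y by (simp add: supp_def)
    have "AE z in ?\<pi>. ennreal (1 - c (fst z) (snd z)) = 0"
      using J by (subst (asm) nn_integral_0_iff_AE) (auto intro!: pairs_measurable[OF s])
    then have "AE z in ?\<pi>. z \<noteq> (x, y)" if "c x y \<noteq> 1"
      by eventually_elim (use that c_le1[of x y] in \<open>auto simp: ennreal_eq_0_iff\<close>)
    moreover have "{z \<in> space ?\<pi>. \<not> z \<noteq> (x, y)} = {(x, y)}"
      using x y sets_eq_imp_space_eq[of ?\<pi> "count_space (S \<times> S)"] s by (auto simp: supp_def)
    ultimately have "c x y = 1"
      using pos x y s AE_iff_measurable[of "{(x, y)}" ?\<pi> "\<lambda>z. z \<noteq> (x, y)"] by (auto simp: supp_def)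
    then show "x \<noteq> y \<and> e x y = 0" by (auto simp: c_def split: if_splits)
  qed
qed

text \<open>Preorder the measures by inclusion of the sets of measures at maximal cost from them. A measure precedes
the Dirac measures at all points of its own support, and by the separation condition on \<open>e\<close> nothing
but itself is preceded by a Dirac measure. The right-hand side mentions only the cost, so every
isometry of the Wasserstein space preserves the property of being a Dirac measure.\<close>

lemma dirac_iff:
  assumes \<mu>: "\<mu> \<in> P"
  shows "(\<exists>x\<in>S. \<mu> = dirac x) \<longleftrightarrow>
    (\<forall>\<nu>\<in>P. (\<forall>\<kappa>\<in>P. cost \<mu> \<kappa> = 1 \<longrightarrow> cost \<nu> \<kappa> = 1) \<longrightarrow> \<nu> = \<mu>)"
proof
  assume "\<exists>x\<in>S. \<mu> = dirac x"
  then obtain x where x: "x \<in> S" "\<mu> = dirac x" by blast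
  show "\<forall>\<nu>\<in>P. (\<forall>\<kappa>\<in>P. cost \<mu> \<kappa> = 1 \<longrightarrow> cost \<nu> \<kappa> = 1) \<longrightarrow> \<nu> = \<mu>"
  proof (intro ballI impI)
    fix \<nu> assume \<nu>: "\<nu> \<in> P" and H: "\<forall>\<kappa>\<in>P. cost \<mu> \<kappa> = 1 \<longrightarrow> cost \<nu> \<kappa> = 1"
    have "y = x" if y: "y \<in> supp \<nu>" for y
    proof (rule ccontr)
      assume "y \<noteq> x"
      moreover have "y \<in> S" using y by (simp add: supp_def)
      \<comment> \<open>The Dirac measure at such a point is at maximal cost from \<open>\<mu>\<close> but not from \<open>\<nu>\<close>.\<close>
      ultimately obtain u where u: "u \<in> S" "u \<noteq> x" "e x u = 0" "u = y \<or> e y u \<noteq> 0"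
        using separating[of x y] x(1) by blast
      have "cost \<mu> (dirac u) = 1"
        using u x by (subst cost_eq_1_iff) (auto simp: dirac_P supp_dirac)
      then have "cost \<nu> (dirac u) = 1" using H dirac_P[OF u(1)] by blast
      then show False
        using u y \<nu> by (subst (asm) cost_eq_1_iff) (auto simp: dirac_P supp_dirac)
    qed
    then show "\<nu> = \<mu>" using eq_dirac_if_supp[OF \<nu> x(1)] x(2) by blast
  qed
next
  assume H: "\<forall>\<nu>\<in>P. (\<forall>\<kappa>\<in>P. cost \<mu> \<kappa> = 1 \<longrightarrow> cost \<nu> \<kappa> = 1) \<longrightarrow> \<nu> = \<mu>"
  obtain x where x: "x \<in> supp \<mu>" using supp_ne[OF \<mu>] by blast
  then have xS: "x \<in> S" by (simp add: supp_def)
  have "cost (dirac x) \<kappa> = 1" if "\<kappa> \<in> P" "cost \<mu> \<kappa> = 1" for \<kappa>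
    using that x by (simp add: cost_eq_1_iff \<mu> dirac_P[OF xS] supp_dirac[OF xS])
  then have "dirac x = \<mu>" using H dirac_P[OF xS] by blast
  then show "\<exists>x\<in>S. \<mu> = dirac x" using xS by blast
qed

section \<open>Distances to Dirac measures determine a measure\<close>

text \<open>Since \<open>c(x,y) = 1 - [x = y] - e(x,y)\<close> and both measures have total mass 1, the difference \<open>\<lambda>\<close> of the
two satisfies \<open>\<lambda>(x) = - \<Sum>\<^sub>y e(x,y) \<lambda>(y)\<close>. The row sums of \<open>e\<close> are at most \<open>1/2\<close>, hence
\<open>\<parallel>\<lambda>\<parallel>\<^sub>1 \<le> \<parallel>\<lambda>\<parallel>\<^sub>1 / 2\<close> and \<open>\<lambda> = 0\<close>.\<close>

lemma eq_if_cost_dirac_eq: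
  assumes \<mu>: "\<mu> \<in> P" and \<nu>: "\<nu> \<in> P"
    and eq: "\<And>x. x \<in> S \<Longrightarrow> cost \<mu> (dirac x) = cost \<nu> (dirac x)"
  shows "\<mu> = \<nu>"
proof -
  let ?C = "count_space S"
  have fm: "finite_measure \<mu>" if "\<mu> \<in> P" for \<mu>
    using P_D(1)[OF that] by (simp add: prob_space_def)
  note em = finite_measure.emeasure_eq_measure[OF fm]
  define R where "R x = (\<integral>\<^sup>+y. ennreal (e x y) * ennreal \<bar>measure \<mu> {y} - measure \<nu> {y}\<bar> \<partial>?C)" for x
  have total: "cost \<mu> (dirac x) + (emeasure \<mu> {x} + (\<integral>\<^sup>+y. ennreal (e x y) * emeasure \<mu> {y} \<partial>?C)) = 1"
    if \<mu>: "\<mu> \<in> P" and x: "x \<in> S" for \<mu> x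
  proof -
    have "emeasure \<mu> {x} = (\<integral>\<^sup>+y. indicator {x} y \<partial>\<mu>)"
      using x P_D[OF \<mu>] by simp
    also have "\<dots> = (\<integral>\<^sup>+y. emeasure \<mu> {y} * indicator {x} y \<partial>?C)"
      by (rule P_nn_integral[OF \<mu>])
    finally have "emeasure \<mu> {x} = (\<integral>\<^sup>+y. emeasure \<mu> {y} * indicator {x} y \<partial>?C)" .
    moreover have "cost \<mu> (dirac x) = (\<integral>\<^sup>+y. emeasure \<mu> {y} * ennreal (c y x) \<partial>?C)"
      unfolding cost_dirac[OF \<mu> x] by (rule P_nn_integral[OF \<mu>])
    ultimately have "cost \<mu> (dirac x) + (emeasure \<mu> {x} + (\<integral>\<^sup>+y. ennreal (e x y) * emeasure \<mu> {y} \<partial>?C))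
      = (\<integral>\<^sup>+y. emeasure \<mu> {y} * ennreal (c y x) + (emeasure \<mu> {y} * indicator {x} y + ennreal (e x y) * emeasure \<mu> {y}) \<partial>?C)"
      by (simp add: nn_integral_add)
    also have "\<dots> = (\<integral>\<^sup>+y. emeasure \<mu> {y} \<partial>?C)"
    proof (rule nn_integral_cong)
      fix y
      have "ennreal (c y x) + (indicator {x} y + ennreal (e x y)) = 1"
        using e_nonneg[of x y] e_le[of x y] 
        by (auto simp: c_def e_refl e_sym[of y x] ennreal_plus[symmetric] simp del: ennreal_plus)
      then have "emeasure \<mu> {y} * (ennreal (c y x) + (indicator {x} y + ennreal (e x y))) = emeasure \<mu> {y} * 1"
        by simp
      then show "emeasure \<mu> {y} * ennreal (c y x) + (emeasure \<mu> {y} * indicator {x} y + ennreal (e x y) * emeasure \<mu> {y}) = emeasure \<mu> {y}"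
        by (simp add: distrib_left mult.commute)
    qed
    finally show ?thesis using P_mass[OF \<mu>] by simp
  qed
  \<comment> \<open>One of the two inequalities behind \<open>\<bar>\<lambda>(x)\<bar> \<le> \<Sum>\<^sub>y e(x,y) \<bar>\<lambda>(y)\<bar>\<close>, which avoids subtraction of extended reals.\<close>
  have half: "measure \<mu> {x} \<le> measure \<nu> {x} + R x" 
    if P: "\<mu> \<in> P" "\<nu> \<in> P" and x: "x \<in> S" and eq: "cost \<mu> (dirac x) = cost \<nu> (dirac x)"
      and R: "R x = (\<integral>\<^sup>+y. ennreal (e x y) * ennreal \<bar>measure \<mu> {y} - measure \<nu> {y}\<bar> \<partial>?C)" for \<mu> \<nu> x
  proof -
    let ?E = "\<lambda>\<mu>. \<integral>\<^sup>+y. ennreal (e x y) * emeasure \<mu> {y} \<partial>?C"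
    have fin: "?E \<mu> \<noteq> \<infinity>" "cost \<mu> (dirac x) \<noteq> \<infinity>"
      using total[OF P(1) x] by (auto simp: infinity_ennreal_def)
    have 1: "emeasure \<mu> {x} + ?E \<mu> = emeasure \<nu> {x} + ?E \<nu>"
      using total[OF P(1) x] total[OF P(2) x] fin(2) unfolding eq
      by (metis ennreal_add_left_cancel)
    have "?E \<nu> \<le> (\<integral>\<^sup>+y. ennreal (e x y) * emeasure \<mu> {y} + ennreal (e x y) * ennreal \<bar>measure \<mu> {y} - measure \<nu> {y}\<bar> \<partial>?C)"
    proof (rule nn_integral_mono)
      fix y
      have "emeasure \<nu> {y} \<le> emeasure \<mu> {y} + ennreal \<bar>measure \<mu> {y} - measure \<nu> {y}\<bar>"
        unfolding em[OF P(1)] em[OF P(2)]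
        by (auto simp: ennreal_plus[symmetric] simp del: ennreal_plus intro!: ennreal_leI)
      then show "ennreal (e x y) * emeasure \<nu> {y} \<le> ennreal (e x y) * emeasure \<mu> {y} + ennreal (e x y) * ennreal \<bar>measure \<mu> {y} - measure \<nu> {y}\<bar>"
        unfolding distrib_left[symmetric] by (rule mult_left_mono) simp
    qed
    also have "\<dots> = ?E \<mu> + R x" unfolding R by (rule nn_integral_add) auto
    finally have "emeasure \<nu> {x} + ?E \<nu> \<le> emeasure \<nu> {x} + (?E \<mu> + R x)"
      by (rule add_left_mono)
    then have "?E \<mu> + emeasure \<mu> {x} \<le> ?E \<mu> + (emeasure \<nu> {x} + R x)"
      unfolding 1[symmetric] by (simp only: ac_simps)
    then have "emeasure \<mu> {x} \<le> emeasure \<nu> {x} + R x"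
      using fin(1) unfolding ennreal_add_left_cancel_le by simp
    then show ?thesis unfolding em[OF P(1)] em[OF P(2)] .
  qed
  let ?f = "\<lambda>x. ennreal \<bar>measure \<mu> {x} - measure \<nu> {x}\<bar>"
  have le: "?f x \<le> R x" if x: "x \<in> S" for x
  proof -
    have "ennreal (measure \<mu> {x}) \<le> measure \<nu> {x} + R x" 
      by (rule half[OF \<mu> \<nu> x eq[OF x]]) (simp add: R_def)
    moreover have "ennreal (measure \<nu> {x}) \<le> measure \<mu> {x} + R x"
      by (rule half[OF \<nu> \<mu> x eq[OF x, symmetric]]) (simp add: R_def abs_minus_commute)
    ultimately show ?thesis
      by (cases "R x") (auto simp: ennreal_plus[symmetric] abs_le_iff simp del: ennreal_plus)
  qed
  let ?L = "\<integral>\<^sup>+x. ?f x \<partial>?C"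
  have "?L \<le> (\<integral>\<^sup>+x. emeasure \<mu> {x} + emeasure \<nu> {x} \<partial>?C)"
    unfolding em[OF \<mu>] em[OF \<nu>]
    by (intro nn_integral_mono)
       (auto simp: ennreal_plus[symmetric] abs_le_iff add_increasing add_increasing2
          simp del: ennreal_plus intro!: ennreal_leI)
  also have "\<dots> = 2" by (simp add: nn_integral_add P_mass \<mu> \<nu>)
  finally have "?L \<le> 2" .
  then have fin: "?L \<noteq> \<infinity>" by (auto simp: infinity_ennreal_def top_unique)
  interpret pair_sigma_finite ?C ?C
    by (intro pair_sigma_finite.intro sigma_finite_measure_count_space_countable countable_S)
  have "?L \<le> (\<integral>\<^sup>+x. R x \<partial>?C)" by (intro nn_integral_mono) (use le in auto)
  also have "\<dots> = (\<integral>\<^sup>+y. (\<integral>\<^sup>+x. ennreal (e x y) * ?f y \<partial>?C) \<partial>?C)"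
    unfolding R_def
    by (rule Fubini'[symmetric]) (simp add: pair_measure_countable countable_S)
  also have "\<dots> = (\<integral>\<^sup>+y. (\<integral>\<^sup>+x. ennreal (e y x) \<partial>?C) * ?f y \<partial>?C)"
    by (intro nn_integral_cong) (subst e_sym, simp add: nn_integral_multc)
  also have "\<dots> \<le> (\<integral>\<^sup>+y. ennreal (1/2) * ?f y \<partial>?C)"
    by (intro nn_integral_mono mult_right_mono) (use e_row in auto)
  also have "\<dots> = ennreal (1/2) * ?L" by (rule nn_integral_cmult) simp
  finally have "?L \<le> ennreal (1/2) * ?L" .
  moreover obtain r where r: "0 \<le> r" "?L = ennreal r"
    using fin by (cases ?L) auto
  ultimately have "ennreal r \<le> ennreal (1/2 * r)"
    by (simp only: ennreal_mult'[symmetric])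
  then have "?L = 0" using r by (simp add: ennreal_le_iff2)
  then have "?f x = 0" if "x \<in> S" for x
    using that by (auto simp: nn_integral_0_iff_AE AE_count_space)
  then show ?thesis by (intro P_eqI[OF \<mu> \<nu>]) (auto simp: em[OF \<mu>] em[OF \<nu>])
qed

section \<open>Isometries of the Wasserstein space are push-forwards\<close>

text \<open>Restricted to \<open>P\<close> because \<^const>\<open>Bij\<close> contains extensional functions only.\<close>

definition push :: "('a \<Rightarrow> 'a) \<Rightarrow> 'a measure \<Rightarrow> 'a measure"
  where "push \<sigma> = (\<lambda>\<mu>\<in>P. distr \<mu> B \<sigma>)"

lemma self_map_measurable: "\<mu> \<in> P \<Longrightarrow> \<sigma> \<in> S \<rightarrow> S \<Longrightarrow> \<sigma> \<in> measurable \<mu> B"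
  using P_D[of \<mu>] by (intro P_measurable) auto

lemma push_P:
  assumes "\<sigma> \<in> S \<rightarrow> S" "\<mu> \<in> P" shows "push \<sigma> \<mu> \<in> P"
  using prob_space.prob_space_distr[OF P_D(1)[OF assms(2)] self_map_measurable[OF assms(2,1)]] assms(2)
  by (simp add: P_def push_def)

lemma push_push:
  assumes "\<sigma> \<in> S \<rightarrow> S" "\<tau> \<in> S \<rightarrow> S" "\<mu> \<in> P"
  shows "push \<tau> (push \<sigma> \<mu>) = push (compose S \<tau> \<sigma>) \<mu>"
proof -
  have "push \<tau> (push \<sigma> \<mu>) = distr (distr \<mu> B \<sigma>) B \<tau>"
    using assms push_P[OF assms(1,3)] by (simp add: push_def)
  also have "\<dots> = distr \<mu> B (\<tau> \<circ> \<sigma>)"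
    using assms by (intro distr_distr self_map_measurable P_measurable) auto
  also have "\<dots> = distr \<mu> B (compose S \<tau> \<sigma>)"
    using P_D(3)[OF assms(3)] by (intro distr_cong) (auto simp: compose_def)
  finally show ?thesis using assms by (simp add: push_def)
qed

lemma push_id: "\<mu> \<in> P \<Longrightarrow> push (\<lambda>x\<in>S. x) \<mu> = \<mu>"
proof -
  assume \<mu>: "\<mu> \<in> P"
  have "push (\<lambda>x\<in>S. x) \<mu> = distr \<mu> B (\<lambda>x. x)"
    using \<mu> P_D(3)[OF \<mu>] by (auto simp: push_def intro!: distr_cong)
  then show "push (\<lambda>x\<in>S. x) \<mu> = \<mu>"
    using P_D(2)[OF \<mu>] by (simp add: distr_id2)
qed

lemma push_dirac: "\<sigma> \<in> S \<rightarrow> S \<Longrightarrow> x \<in> S \<Longrightarrow> push \<sigma> (dirac x) = dirac (\<sigma> x)"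
  by (simp add: push_def dirac_P distr_return P_measurable image_subset_iff Pi_iff)

text \<open>A coupling can be pushed forward along \<open>\<sigma>\<close> in both coordinates at unchanged cost. Equality will
follow by applying this to the inverse of \<open>\<sigma>\<close> as well.\<close>

lemma cost_push_le:
  assumes \<sigma>: "\<sigma> \<in> S \<rightarrow> S" and c: "\<And>x y. x \<in> S \<Longrightarrow> y \<in> S \<Longrightarrow> c (\<sigma> x) (\<sigma> y) = c x y"
    and P: "\<mu> \<in> P" "\<nu> \<in> P"
  shows "cost (push \<sigma> \<mu>) (push \<sigma> \<nu>) \<le> cost \<mu> \<nu>"
  unfolding cost_def
proof (rule INF_mono)
  fix \<pi> assume \<pi>: "\<pi> \<in> couplings (mtopology_of X) \<mu> \<nu>"
  have s: "sets \<pi> = Pow (S \<times> S)" and m: "distr \<pi> B fst = \<mu>" "distr \<pi> B snd = \<nu>"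
    and pr: "prob_space \<pi>"
    using \<pi> unfolding couplings_X by auto
  have sp: "space \<pi> = S \<times> S" using sets_eq_imp_space_eq[of \<pi> "count_space (S \<times> S)"] s by simp
  \<comment> \<open>Only the measurable sets of \<open>N\<close> matter: it is the target of the push-forward of couplings.\<close>
  define N where "N = sigma (S \<times> S) (Pow (S \<times> S))"
  have N: "sets N = Pow (S \<times> S)" "space N = S \<times> S"
    unfolding N_def by (simp_all add: sigma_algebra.sigma_sets_eq[OF sigma_algebra_Pow])
  have mm: "map_prod \<sigma> \<sigma> \<in> measurable \<pi> N"
    using \<sigma> by (intro pairs_measurable[OF s]) (auto simp: N)
  let ?\<pi> = "distr \<pi> N (map_prod \<sigma> \<sigma>)"
  have "distr ?\<pi> B fst = distr \<pi> B (fst \<circ> map_prod \<sigma> \<sigma>)"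
    by (rule distr_distr[OF _ mm]) (auto intro!: pairs_measurable simp: N)
  also have "\<dots> = distr \<pi> B (\<sigma> \<circ> fst)" by (simp add: fst_comp_map_prod)
  also have "\<dots> = distr (distr \<pi> B fst) B \<sigma>"
    using \<sigma> by (intro distr_distr[symmetric] P_measurable pairs_measurable[OF s]) auto
  finally have 1: "distr ?\<pi> B fst = push \<sigma> \<mu>" using P by (simp add: m push_def)
  have "distr ?\<pi> B snd = distr \<pi> B (snd \<circ> map_prod \<sigma> \<sigma>)"
    by (rule distr_distr[OF _ mm]) (auto intro!: pairs_measurable simp: N)
  also have "\<dots> = distr \<pi> B (\<sigma> \<circ> snd)" by (simp add: snd_comp_map_prod)
  also have "\<dots> = distr (distr \<pi> B snd) B \<sigma>"
    using \<sigma> by (intro distr_distr[symmetric] P_measurable pairs_measurable[OF s]) auto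
  finally have 2: "distr ?\<pi> B snd = push \<sigma> \<nu>" using P by (simp add: m push_def)
  have "?\<pi> \<in> couplings (mtopology_of X) (push \<sigma> \<mu>) (push \<sigma> \<nu>)"
    unfolding couplings_X using 1 2 prob_space.prob_space_distr[OF pr mm] by (simp add: N)
  moreover have "(\<integral>\<^sup>+ z. ennreal (c (fst z) (snd z)) \<partial>?\<pi>) = (\<integral>\<^sup>+ z. ennreal (c (fst z) (snd z)) \<partial>\<pi>)"
    by (subst nn_integral_distr[OF mm])
       (auto intro!: pairs_measurable nn_integral_cong simp: N sp c)
  ultimately show "\<exists>\<pi>'\<in>couplings (mtopology_of X) (push \<sigma> \<mu>) (push \<sigma> \<nu>).
      (\<integral>\<^sup>+ z. ennreal (c (fst z) (snd z)) \<partial>\<pi>') \<le> (\<integral>\<^sup>+ z. ennreal (c (fst z) (snd z)) \<partial>\<pi>)"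
    by (intro bexI[of _ ?\<pi>]) auto
qed

definition sym_group :: "('a \<Rightarrow> 'a) set"
  where "sym_group = {\<sigma> \<in> Bij S. \<forall>x\<in>S. \<forall>y\<in>S. e (\<sigma> x) (\<sigma> y) = e x y}"

lemma symD:
  assumes "\<sigma> \<in> sym_group"
  shows "\<sigma> \<in> S \<rightarrow> S" "bij_betw \<sigma> S S" "\<And>x y. x \<in> S \<Longrightarrow> y \<in> S \<Longrightarrow> c (\<sigma> x) (\<sigma> y) = c x y"
  using assms by (auto simp: sym_group_def Bij_def bij_betw_def c_def inj_on_eq_iff)

lemma sym_inv:
  assumes "\<sigma> \<in> sym_group" shows "restrict (inv_into S \<sigma>) S \<in> sym_group"
proof -
  have b: "\<sigma> \<in> Bij S" using assms by (simp add: sym_group_def)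
  have "e (inv_into S \<sigma> x) (inv_into S \<sigma> y) = e x y" if "x \<in> S" "y \<in> S" for x y
  proof -
    have f: "\<sigma> (inv_into S \<sigma> x) = x" "\<sigma> (inv_into S \<sigma> y) = y"
      using symD(2)[OF assms] that by (auto simp: bij_betw_def f_inv_into_f)
    have "e (\<sigma> (inv_into S \<sigma> x)) (\<sigma> (inv_into S \<sigma> y)) = e (inv_into S \<sigma> x) (inv_into S \<sigma> y)"
      using assms Bij_inv_into_mem[OF b that(1)] Bij_inv_into_mem[OF b that(2)]
      by (simp add: sym_group_def)
    then show ?thesis by (simp only: f)
  qed
  then show ?thesis using restrict_inv_into_Bij[OF b] by (simp add: sym_group_def)
qed

lemma push_inv:
  assumes "\<sigma> \<in> sym_group" "\<mu> \<in> P"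
  shows "push (restrict (inv_into S \<sigma>) S) (push \<sigma> \<mu>) = \<mu>"
    and "push \<sigma> (push (restrict (inv_into S \<sigma>) S) \<mu>) = \<mu>"
proof -
  note s = symD(1,2)[OF assms(1)] and t = symD(1)[OF sym_inv[OF assms(1)]]
  have "compose S (restrict (inv_into S \<sigma>) S) \<sigma> = (\<lambda>x\<in>S. x)"
    using s by (intro compose_inv_into_id)
  then show "push (restrict (inv_into S \<sigma>) S) (push \<sigma> \<mu>) = \<mu>"
    using push_push[OF s(1) t assms(2)] push_id[OF assms(2)] by simp
  have "compose S \<sigma> (restrict (inv_into S \<sigma>) S) = (\<lambda>x\<in>S. x)"
    using s(2) by (auto simp: compose_def bij_betw_def f_inv_into_f fun_eq_iff)
  then show "push \<sigma> (push (restrict (inv_into S \<sigma>) S) \<mu>) = \<mu>"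
    using push_push[OF t s(1) assms(2)] push_id[OF assms(2)] by simp
qed

lemma cost_push:
  assumes "\<sigma> \<in> sym_group" and P: "\<mu> \<in> P" "\<nu> \<in> P"
  shows "cost (push \<sigma> \<mu>) (push \<sigma> \<nu>) = cost \<mu> \<nu>"
proof (rule antisym)
  note s = symD[OF assms(1)] and t = symD[OF sym_inv[OF assms(1)]]
  show "cost (push \<sigma> \<mu>) (push \<sigma> \<nu>) \<le> cost \<mu> \<nu>"
    by (rule cost_push_le) (use s P in auto)
  show "cost \<mu> \<nu> \<le> cost (push \<sigma> \<mu>) (push \<sigma> \<nu>)"
    using cost_push_le[OF t(1,3) push_P[OF s(1) P(1)] push_P[OF s(1) P(2)]]
    by (simp only: push_inv[OF assms(1)] P)
qed

definition W_isom :: "('a measure \<Rightarrow> 'a measure) set"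
  where "W_isom = {\<Phi> \<in> Bij P. \<forall>\<mu>\<in>P. \<forall>\<nu>\<in>P. cost (\<Phi> \<mu>) (\<Phi> \<nu>) = cost \<mu> \<nu>}"

lemma push_isom:
  assumes "\<sigma> \<in> sym_group" shows "push \<sigma> \<in> W_isom"
proof -
  note s = symD(1)[OF assms] and t = symD(1)[OF sym_inv[OF assms]]
  have "bij_betw (push \<sigma>) P P"
    by (rule bij_betw_byWitness[where f' = "push (restrict (inv_into S \<sigma>) S)"])
       (use push_inv[OF assms] push_P[OF s] push_P[OF t] in auto)
  then show ?thesis
    using cost_push[OF assms] by (auto simp: W_isom_def Bij_def push_def)
qed

lemma isom_dirac:
  assumes "\<Phi> \<in> W_isom" and "\<mu> \<in> P"
  shows "(\<exists>y\<in>S. \<Phi> \<mu> = dirac y) \<longleftrightarrow> (\<exists>x\<in>S. \<mu> = dirac x)"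
proof -
  have b: "bij_betw \<Phi> P P" and d: "\<And>\<mu> \<nu>. \<mu> \<in> P \<Longrightarrow> \<nu> \<in> P \<Longrightarrow> cost (\<Phi> \<mu>) (\<Phi> \<nu>) = cost \<mu> \<nu>"
    using assms by (auto simp: W_isom_def Bij_def)
  then have im: "\<Phi> ` P = P" and \<Phi>: "\<And>\<mu>. \<mu> \<in> P \<Longrightarrow> \<Phi> \<mu> \<in> P"
    and inj: "\<And>\<mu> \<nu>. \<mu> \<in> P \<Longrightarrow> \<nu> \<in> P \<Longrightarrow> \<Phi> \<mu> = \<Phi> \<nu> \<longleftrightarrow> \<mu> = \<nu>"
    by (auto simp: bij_betw_def inj_on_eq_iff)
  \<comment> \<open>Surjectivity of \<open>\<Phi>\<close> transports the quantifiers of the metric characterisation.\<close>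
  have all: "(\<forall>\<nu>\<in>P. Q \<nu>) \<longleftrightarrow> (\<forall>\<nu>\<in>P. Q (\<Phi> \<nu>))" for Q
    by (subst im[symmetric]) auto
  show ?thesis
    unfolding dirac_iff[OF assms(2)] dirac_iff[OF \<Phi>[OF assms(2)]]
    by (subst all, subst all) (simp add: d inj assms(2))
qed

text \<open>On Dirac measures \<open>\<Phi>\<close> acts as a map \<open>\<sigma>\<close> of the points, which preserves \<open>c\<close> because \<open>c\<close> is the cost
between Dirac measures. Then \<open>\<Phi> \<mu>\<close> and the push-forward of \<open>\<mu>\<close> along \<open>\<sigma>\<close> have the same distances to
all Dirac measures and therefore agree.\<close>

lemma isom_eq_push:
  assumes \<Phi>: "\<Phi> \<in> W_isom" shows "\<exists>\<sigma>\<in>sym_group. \<Phi> = push \<sigma>"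
proof -
  have b: "bij_betw \<Phi> P P" and ext: "\<Phi> \<in> extensional P"
    and d: "\<And>\<mu> \<nu>. \<mu> \<in> P \<Longrightarrow> \<nu> \<in> P \<Longrightarrow> cost (\<Phi> \<mu>) (\<Phi> \<nu>) = cost \<mu> \<nu>"
    using assms by (auto simp: W_isom_def Bij_def)
  have dirac_inj: "x = y" if "x \<in> S" "y \<in> S" "dirac x = dirac y" for x y
    using supp_dirac[OF that(1)] supp_dirac[OF that(2)] that(3) by (metis singleton_inject)
  have "\<forall>x\<in>S. \<exists>y\<in>S. \<Phi> (dirac x) = dirac y"
    using isom_dirac[OF \<Phi> dirac_P] by blast
  then obtain f where f: "\<And>x. x \<in> S \<Longrightarrow> f x \<in> S" "\<And>x. x \<in> S \<Longrightarrow> \<Phi> (dirac x) = dirac (f x)"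
    by metis
  define \<sigma> where "\<sigma> = restrict f S"
  have \<sigma>: "\<sigma> \<in> S \<rightarrow> S" "\<And>x. x \<in> S \<Longrightarrow> \<Phi> (dirac x) = dirac (\<sigma> x)"
    using f by (auto simp: \<sigma>_def)
  have "inj_on \<sigma> S"
    using b \<sigma> dirac_P dirac_inj by (intro inj_onI) (metis bij_betw_def inj_on_def)
  moreover have "y \<in> \<sigma> ` S" if y: "y \<in> S" for y
  proof -
    obtain \<mu> where "\<mu> \<in> P" "\<Phi> \<mu> = dirac y"
      using b dirac_P[OF y] unfolding bij_betw_def by (metis imageE)
    then obtain x where "x \<in> S" "\<Phi> (dirac x) = dirac y"
      using isom_dirac[OF \<Phi>] y by blast
    then show ?thesis using \<sigma> y dirac_inj by (metis Pi_mem image_eqI)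
  qed
  ultimately have bij: "bij_betw \<sigma> S S" using \<sigma>(1) by (auto simp: bij_betw_def)
  have c: "c (\<sigma> x) (\<sigma> y) = c x y" if "x \<in> S" "y \<in> S" for x y
  proof -
    have "ennreal (c (\<sigma> x) (\<sigma> y)) = cost (\<Phi> (dirac x)) (\<Phi> (dirac y))"
      using that \<sigma> by (simp add: cost_dirac_dirac Pi_iff)
    also have "\<dots> = ennreal (c x y)" using that by (simp add: d dirac_P cost_dirac_dirac)
    finally show ?thesis by (simp add: c_nonneg)
  qed
  have "e (\<sigma> x) (\<sigma> y) = e x y" if "x \<in> S" "y \<in> S" for x y
    using c[OF that] bij that by (auto simp: c_def bij_betw_def inj_on_eq_iff e_refl split: if_splits)
  then have sym: "\<sigma> \<in> sym_group"
    using bij by (auto simp: sym_group_def Bij_def \<sigma>_def)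
  moreover have "\<Phi> = push \<sigma>"
  proof (rule extensionalityI[OF ext])
    show "push \<sigma> \<in> extensional P" by (simp add: push_def)
    fix \<mu> assume \<mu>: "\<mu> \<in> P"
    have \<Phi>\<mu>: "\<Phi> \<mu> \<in> P" using b \<mu> by (auto simp: bij_betw_def)
    show "\<Phi> \<mu> = push \<sigma> \<mu>"
    proof (rule eq_if_cost_dirac_eq[OF \<Phi>\<mu> push_P[OF \<sigma>(1) \<mu>]])
      fix y assume "y \<in> S"
      then obtain x where x: "x \<in> S" "y = \<sigma> x" using bij by (auto simp: bij_betw_def)
      have "cost (\<Phi> \<mu>) (dirac y) = cost \<mu> (dirac x)"
        using x \<sigma>(2) d[OF \<mu> dirac_P[OF x(1)]] by simp
      also have "\<dots> = cost (push \<sigma> \<mu>) (push \<sigma> (dirac x))"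
        using cost_push[OF sym \<mu> dirac_P[OF x(1)]] by simp
      also have "\<dots> = cost (push \<sigma> \<mu>) (dirac y)"
        using x push_dirac[OF \<sigma>(1)] by simp
      finally show "cost (\<Phi> \<mu>) (dirac y) = cost (push \<sigma> \<mu>) (dirac y)" .
    qed
  qed
  ultimately show ?thesis by blast
qed

lemma isometry_group_W:
  "isometry_group (wasserstein_space p X) (wasserstein_dist p X) = BijGroup P \<lparr>carrier := W_isom\<rparr>"
proof -
  have "{f \<in> Bij P. \<forall>x\<in>P. \<forall>y\<in>P. wasserstein_dist p X (f x) (f y) = wasserstein_dist p X x y} = W_isom"
    unfolding W_isom_def using Bij_imp_funcset[of _ P]
    by (intro Collect_cong conj_cong refl ball_cong) (auto simp: cost_eq_iff Pi_iff)
  then show ?thesis unfolding isometry_group_def wasserstein_space_X by simp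
qed

text \<open>The carrier on the left consists of the permutations of \<open>S\<close> that preserve \<open>e\<close>; these are the
isometries of the base space, since \<open>c\<close> and \<open>e\<close> determine each other.\<close>

theorem wasserstein_rigidity:
  "isometry_group S e \<cong> isometry_group (wasserstein_space p X) (wasserstein_dist p X)"
proof -
  have e: "isometry_group S e = BijGroup S \<lparr>carrier := sym_group\<rparr>"
    by (simp add: isometry_group_def sym_group_def)
  have "push \<in> iso (BijGroup S \<lparr>carrier := sym_group\<rparr>) (BijGroup P \<lparr>carrier := W_isom\<rparr>)"
  proof (rule isoI)
    show "push \<in> hom (BijGroup S \<lparr>carrier := sym_group\<rparr>) (BijGroup P \<lparr>carrier := W_isom\<rparr>)"
    proof (rule homI; simp)
      show "push \<sigma> \<in> W_isom" if "\<sigma> \<in> sym_group" for \<sigma> using push_isom[OF that] .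
      fix \<tau> \<sigma> assume \<tau>: "\<tau> \<in> sym_group" and \<sigma>: "\<sigma> \<in> sym_group"
      have "push (compose S \<tau> \<sigma>) = compose P (push \<tau>) (push \<sigma>)"
      proof (rule extensionalityI[of _ P])
        show "push (compose S \<tau> \<sigma>) \<in> extensional P" by (simp add: push_def)
        show "compose P (push \<tau>) (push \<sigma>) \<in> extensional P" by (rule compose_extensional)
        show "push (compose S \<tau> \<sigma>) \<mu> = compose P (push \<tau>) (push \<sigma>) \<mu>" if "\<mu> \<in> P" for \<mu>
          using push_push[OF symD(1)[OF \<sigma>] symD(1)[OF \<tau>] that] that by (simp add: compose_eq)
      qed
      moreover have "\<tau> \<in> Bij S" "\<sigma> \<in> Bij S" "push \<tau> \<in> Bij P" "push \<sigma> \<in> Bij P"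
        using \<tau> \<sigma> push_isom by (auto simp: sym_group_def W_isom_def)
      ultimately show "push (\<tau> \<otimes>\<^bsub>BijGroup S\<^esub> \<sigma>) = push \<tau> \<otimes>\<^bsub>BijGroup P\<^esub> push \<sigma>"
        by (simp add: BijGroup_def)
    qed
    have "inj_on push sym_group"
    proof (rule inj_onI)
      fix \<sigma> \<tau> assume \<sigma>: "\<sigma> \<in> sym_group" and \<tau>: "\<tau> \<in> sym_group" and eq: "push \<sigma> = push \<tau>"
      have "\<sigma> x = \<tau> x" if x: "x \<in> S" for x
      proof -
        have S: "\<sigma> x \<in> S" "\<tau> x \<in> S" using symD(1)[OF \<sigma>] symD(1)[OF \<tau>] x by auto
        have "dirac (\<sigma> x) = dirac (\<tau> x)"
          using push_dirac[OF symD(1)[OF \<sigma>] x] push_dirac[OF symD(1)[OF \<tau>] x] eq by metis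
        then have "{\<sigma> x} = {\<tau> x}" using supp_dirac[OF S(1)] supp_dirac[OF S(2)] by metis
        then show ?thesis by simp
      qed
      then show "\<sigma> = \<tau>" using \<sigma> \<tau> 
        by (intro extensionalityI[of _ S]) (auto simp: sym_group_def Bij_def)
    qed
    moreover have "push ` sym_group = W_isom" using push_isom isom_eq_push by blast
    ultimately show "bij_betw push (carrier (BijGroup S \<lparr>carrier := sym_group\<rparr>)) (carrier (BijGroup P \<lparr>carrier := W_isom\<rparr>))"
      by (simp add: bij_betw_def)
  qed
  then show ?thesis unfolding e isometry_group_W is_iso_def by blast
qed

end

section \<open>A coloured graph whose symmetry group is a given group\<close>

text \<open>The vertices are four copies (levels) of the group, arranged in a cycle. The edge from \<open>g\<close> in
level \<open>i\<close> to \<open>h\<close> in level \<open>i + 1\<close> is coloured by \<open>(g\<inverse> h, i)\<close>; left translations are the only maps that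
preserve all these colours. Four levels, rather than two or three, make the graph triangle-free with
all degrees at least 2 even if the group is trivial, which yields the separation condition. A code
for pairs of a group element and a level serves twice: it turns vertices into real numbers and
colours into summable weights.\<close>

locale layered_cayley = group H for H :: "('h, 'm) monoid_scheme" (structure) +
  fixes code :: "'h \<times> nat \<Rightarrow> nat"
  assumes code_inj: "inj_on code (carrier H \<times> {..<4})"
begin

definition K :: "('h \<times> nat) set" where "K = carrier H \<times> {..<4}"

definition pt :: "'h \<times> nat \<Rightarrow> real" where "pt z = real (code z)"

definition S :: "real set" where "S = pt ` K"

definition grp :: "real \<Rightarrow> 'h" where "grp x = fst (inv_into K pt x)"

definition lev :: "real \<Rightarrow> nat" where "lev x = snd (inv_into K pt x)"

definition w :: "'h \<times> nat \<Rightarrow> real" where "w z = (1/2) ^ (code z + 3)"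

definition e :: "real \<Rightarrow> real \<Rightarrow> real"
  where "e x y = (if x \<notin> S \<or> y \<notin> S then 0
     else if lev y = Suc (lev x) mod 4 then w (inv (grp x) \<otimes> grp y, lev x)
     else if lev x = Suc (lev y) mod 4 then w (inv (grp y) \<otimes> grp x, lev y)
     else 0)"

lemma pt_inj: "inj_on pt K"
  using code_inj by (auto simp: pt_def K_def inj_on_def)

lemma grp_pt [simp]: "g \<in> carrier H \<Longrightarrow> i < 4 \<Longrightarrow> grp (pt (g, i)) = g"
  and lev_pt [simp]: "g \<in> carrier H \<Longrightarrow> i < 4 \<Longrightarrow> lev (pt (g, i)) = i"
  and pt_S [simp]: "g \<in> carrier H \<Longrightarrow> i < 4 \<Longrightarrow> pt (g, i) \<in> S"
  using pt_inj by (auto simp: grp_def lev_def S_def K_def)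

lemma S_D:
  assumes "x \<in> S" shows grp_S: "grp x \<in> carrier H" and lev_S: "lev x < 4" 
    and pt_grp_lev: "pt (grp x, lev x) = x"
  using assms by (auto simp: S_def K_def)

lemma S_eqI: "x \<in> S \<Longrightarrow> y \<in> S \<Longrightarrow> grp x = grp y \<Longrightarrow> lev x = lev y \<Longrightarrow> x = y"
  by (metis pt_grp_lev)

lemma w_pos: "0 < w z" and w_le: "w z \<le> 1/8"
proof -
  show "0 < w z" by (simp add: w_def)
  have "(1/2::real) ^ (code z + 3) \<le> (1/2) ^ 3" by (intro power_decreasing) auto
  then show "w z \<le> 1/8" by (simp add: w_def power3_eq_cube)
qed

lemma w_eq_iff: "z \<in> K \<Longrightarrow> z' \<in> K \<Longrightarrow> w z = w z' \<longleftrightarrow> z = z'"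
  using code_inj by (simp add: w_def K_def power_one_over inj_on_eq_iff)

lemma mod4_cases: "i < 4 \<Longrightarrow> i = 0 \<or> i = 1 \<or> i = 2 \<or> i = (3::nat)" by arith

lemma e_sym: "e x y = e y x"
  using mod4_cases[OF lev_S[of x]] mod4_cases[OF lev_S[of y]] by (auto simp: e_def)

lemma e_step: "x \<in> S \<Longrightarrow> y \<in> S \<Longrightarrow> lev y = Suc (lev x) mod 4 \<Longrightarrow>
    e x y = w (inv (grp x) \<otimes> grp y, lev x)"
  by (simp add: e_def)

lemma e_eq_0_iff: "x \<in> S \<Longrightarrow> y \<in> S \<Longrightarrow>
    e x y = 0 \<longleftrightarrow> lev y \<noteq> Suc (lev x) mod 4 \<and> lev x \<noteq> Suc (lev y) mod 4"
  using w_pos by (auto simp: e_def less_imp_neq[symmetric])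

text \<open>The colours of the edges at a fixed vertex are pairwise distinct, so a row sum is part of the
geometric series \<open>\<Sum>\<^sub>n 2\<^sup>-\<^sup>n\<^sup>-\<^sup>3 = 1/4\<close>.\<close>

lemma e_row:
  assumes x: "x \<in> S" shows "(\<integral>\<^sup>+y. ennreal (e x y) \<partial>count_space S) \<le> ennreal (1/2)"
proof -
  define A where "A = {y\<in>S. e x y \<noteq> 0}"
  \<comment> \<open>\<open>q y\<close> is the colour of the edge between \<open>x\<close> and \<open>y\<close>.\<close>
  define q where "q y = (if lev y = Suc (lev x) mod 4 then (inv (grp x) \<otimes> grp y, lev x)
      else (inv (grp y) \<otimes> grp x, lev y))" for y
  have A: "y \<in> S" "lev y = Suc (lev x) mod 4 \<or> lev x = Suc (lev y) mod 4" "e x y = w (q y)" if "y \<in> A" for y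
    using that x by (auto simp: A_def e_def q_def split: if_splits)
  have q_K: "q y \<in> K" if "y \<in> A" for y
    using A(1)[OF that] x S_D by (auto simp: q_def K_def)
  have "inj_on q A"
  proof (rule inj_onI)
    fix y z assume y: "y \<in> A" and z: "z \<in> A" and eq: "q y = q z"
    note cy = mod4_cases[OF lev_S[OF A(1)[OF y]]] and cz = mod4_cases[OF lev_S[OF A(1)[OF z]]]
    have l: "lev y = lev z"
      using eq A(2)[OF y] A(2)[OF z] cy cz by (auto simp: q_def split: if_splits)
    moreover have "grp y = grp z"
    proof -
      have g: "grp y \<in> carrier H" "grp z \<in> carrier H" "grp x \<in> carrier H"
        using grp_S A(1)[OF y] A(1)[OF z] x by auto
      have "inv (grp x) \<otimes> grp y = inv (grp x) \<otimes> grp z \<or> inv (grp y) \<otimes> grp x = inv (grp z) \<otimes> grp x"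
        using eq l by (auto simp: q_def split: if_splits)
      then show ?thesis using g by (metis inv_closed inv_inv Units_eq Units_l_cancel right_cancel)
    qed
    ultimately show "y = z" using A(1)[OF y] A(1)[OF z] by (intro S_eqI)
  qed
  then have inj: "inj_on (code \<circ> q) A"
    using q_K code_inj by (intro comp_inj_on) (auto simp: K_def intro: inj_on_subset)
  have "(\<integral>\<^sup>+y. ennreal (e x y) \<partial>count_space S) = (\<integral>\<^sup>+y. ennreal (e x y) \<partial>count_space A)"
    by (rule nn_integral_count_space_eq) (auto simp: A_def)
  also have "\<dots> = (\<integral>\<^sup>+y. ennreal ((1/2) ^ ((code \<circ> q) y + 3)) \<partial>count_space A)"
    by (intro nn_integral_cong) (simp add: A w_def)
  also have "\<dots> = (\<integral>\<^sup>+n. ennreal ((1/2) ^ (n + 3)) \<partial>count_space ((code \<circ> q) ` A))"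
    by (rule nn_integral_bij_count_space[OF inj_on_imp_bij_betw[OF inj]])
  also have "\<dots> = (\<integral>\<^sup>+n. ennreal ((1/2) ^ (n + 3)) * indicator ((code \<circ> q) ` A) n \<partial>count_space UNIV)"
    by (rule nn_integral_count_space_indicator) simp
  also have "\<dots> \<le> (\<integral>\<^sup>+n. ennreal ((1/2) ^ (n + 3)) \<partial>count_space UNIV)"
    by (intro nn_integral_mono) (auto simp: indicator_def)
  also have "\<dots> = (\<Sum>n. ennreal ((1/2) ^ (n + 3)))" by (rule nn_integral_count_space_nat)
  also have "\<dots> = ennreal (\<Sum>n. (1/2) ^ (n + 3))"
    by (rule suminf_ennreal2) (auto simp: power_add intro!: summable_mult2 summable_geometric)
  also have "(\<Sum>n. (1/2::real) ^ (n + 3)) = (\<Sum>n. (1/2) ^ n) * (1/8)"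
    by (subst suminf_mult2) (auto simp: power_add power3_eq_cube intro!: summable_geometric)
  also have "\<dots> = 1/4" by (subst suminf_geometric) auto
  finally show ?thesis by (rule order_trans) (rule ennreal_leI, simp)
qed

text \<open>If \<open>y\<close> is adjacent to \<open>x\<close>, then the level opposite to that of \<open>x\<close> in the 4-cycle is adjacent to the
level of \<open>y\<close> on the other side, so any of its points will do.\<close>

lemma e_separating:
  assumes x: "x \<in> S" and y: "y \<in> S" and "x \<noteq> y"
  shows "\<exists>u\<in>S. u \<noteq> x \<and> e x u = 0 \<and> (u = y \<or> e y u \<noteq> 0)"
proof (cases "e x y = 0")
  case True
  then show ?thesis using assms by (intro bexI[of _ y]) auto
next
  case False
  let ?u = "pt (\<one>, (lev x + 2) mod 4)"
  have u: "?u \<in> S" "lev ?u = (lev x + 2) mod 4" by auto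
  note cx = mod4_cases[OF lev_S[OF x]] and cy = mod4_cases[OF lev_S[OF y]]
  have "lev ?u \<noteq> lev x" unfolding u(2) using cx by auto
  then have "?u \<noteq> x" by metis
  moreover have "e x ?u = 0" 
    using cx unfolding e_eq_0_iff[OF x u(1)] u(2) by auto
  moreover have "e y ?u \<noteq> 0" 
    using False cx cy unfolding e_eq_0_iff[OF y u(1)] e_eq_0_iff[OF x y] u(2) by auto
  ultimately show ?thesis using u(1) by metis
qed

lemma near_uniform: "1 \<le> p \<Longrightarrow> near_uniform_space S e p"
proof
  show "countable S" unfolding S_def pt_def
    by (rule countable_subset[of _ "range real"]) auto
  show "S \<noteq> {}" by (metis empty_iff one_closed pt_S zero_less_numeral)
  show "e x y = e y x" for x y by (rule e_sym)
  show "e x x = 0" for x using mod4_cases[OF lev_S[of x]] by (auto simp: e_def)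
  show "0 \<le> e x y" for x y using w_pos less_imp_le by (auto simp: e_def)
  show "e x y \<le> 1/2" for x y
  proof -
    have "w z \<le> 1/2" for z using w_le[of z] by simp
    then show ?thesis by (auto simp: e_def)
  qed
qed (use e_row e_separating in auto)

lemma e_eq_w:
  assumes "x \<in> S" "y \<in> S" "(k, i) \<in> K" "e x y = w (k, i)"
  shows "lev x = i \<and> lev y = Suc i mod 4 \<and> k = inv (grp x) \<otimes> grp y \<or>
         lev y = i \<and> lev x = Suc i mod 4 \<and> k = inv (grp y) \<otimes> grp x"
proof -
  have "(inv (grp x) \<otimes> grp y, lev x) \<in> K" "(inv (grp y) \<otimes> grp x, lev y) \<in> K"
    using S_D assms by (auto simp: K_def)
  then show ?thesis
    using assms w_pos[of "(k, i)"] by (auto simp: e_def w_eq_iff split: if_splits)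
qed

definition trans :: "'h \<Rightarrow> real \<Rightarrow> real"
  where "trans h = (\<lambda>x\<in>S. pt (h \<otimes> grp x, lev x))"

lemma trans_S: "h \<in> carrier H \<Longrightarrow> x \<in> S \<Longrightarrow>
    trans h x \<in> S \<and> grp (trans h x) = h \<otimes> grp x \<and> lev (trans h x) = lev x"
  using S_D[of x] by (simp add: trans_def)

lemma trans_compose:
  "g \<in> carrier H \<Longrightarrow> h \<in> carrier H \<Longrightarrow> trans (g \<otimes> h) = compose S (trans g) (trans h)"
proof (rule extensionalityI[of _ S])
  assume gh: "g \<in> carrier H" "h \<in> carrier H"
  fix x assume x: "x \<in> S"
  show "trans (g \<otimes> h) x = compose S (trans g) (trans h) x"
    using trans_S[OF gh(2) x] trans_S[OF gh(1), of "trans h x"] trans_S[OF m_closed[OF gh] x] x gh grp_S[OF x]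
    by (intro S_eqI) (auto simp: compose_eq m_assoc)
qed (auto simp: trans_def compose_def)

lemma trans_one: "trans \<one> = (\<lambda>x\<in>S. x)"
  by (auto simp: trans_def fun_eq_iff S_D)

lemma trans_Bij: assumes h: "h \<in> carrier H" shows "trans h \<in> Bij S"
proof -
  have "bij_betw (trans h) S S"
  proof (rule bij_betw_byWitness[where f' = "trans (inv h)"])
    show "\<forall>x\<in>S. trans (inv h) (trans h x) = x"
      using trans_compose[of "inv h" h] trans_one h by (auto simp: compose_def fun_eq_iff) (metis restrict_apply')
    show "\<forall>x\<in>S. trans h (trans (inv h) x) = x"
      using trans_compose[of h "inv h"] trans_one h by (auto simp: compose_def fun_eq_iff) (metis restrict_apply')
  qed (use trans_S h in auto)
  then show ?thesis by (simp add: Bij_def trans_def)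
qed

lemma trans_e:
  assumes h: "h \<in> carrier H" and x: "x \<in> S" and y: "y \<in> S" shows "e (trans h x) (trans h y) = e x y"
proof -
  have *: "inv (h \<otimes> a) \<otimes> (h \<otimes> b) = inv a \<otimes> b" if "a \<in> carrier H" "b \<in> carrier H" for a b
    using h that by (simp add: inv_mult_group m_assoc) (simp add: m_assoc[symmetric])
  show ?thesis
    using trans_S[OF h x] trans_S[OF h y] x y grp_S by (auto simp: e_def *)
qed

text \<open>A colour-preserving permutation maps each edge between levels \<open>i\<close> and \<open>i + 1\<close> to an edge between the
same two levels, possibly reversed. As each vertex lies on an edge of both adjacent kinds, its level is
preserved and no edge is reversed. The element \<open>grp (\<sigma> x) \<otimes> inv (grp x)\<close> is then the same at both ends
of every edge, hence constant along the cycle of levels, and its value is the translation sought.\<close>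

lemma aut_is_trans:
  assumes "\<sigma> \<in> Bij S" and e\<sigma>: "\<And>x y. x \<in> S \<Longrightarrow> y \<in> S \<Longrightarrow> e (\<sigma> x) (\<sigma> y) = e x y"
  shows "\<exists>h\<in>carrier H. \<sigma> = trans h"
proof -
  have \<sigma>: "\<sigma> x \<in> S" if "x \<in> S" for x using assms(1) that Bij_imp_funcset by blast
  have step: "lev (\<sigma> x) = lev x \<and> lev (\<sigma> y) = Suc (lev x) mod 4 \<and> inv (grp x) \<otimes> grp y = inv (grp (\<sigma> x)) \<otimes> grp (\<sigma> y) \<or>
         lev (\<sigma> y) = lev x \<and> lev (\<sigma> x) = Suc (lev x) mod 4 \<and> inv (grp x) \<otimes> grp y = inv (grp (\<sigma> y)) \<otimes> grp (\<sigma> x)"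
    if "x \<in> S" "y \<in> S" "lev y = Suc (lev x) mod 4" for x y
    using that S_D e_step[OF that] e\<sigma>[OF that(1,2)]
    by (intro e_eq_w \<sigma>) (auto simp: K_def)
  have lev\<sigma>: "lev (\<sigma> x) = lev x" if x: "x \<in> S" for x
  proof -
    \<comment> \<open>One neighbour in the next level and one in the preceding level, which is \<open>lev x + 3\<close> modulo 4.\<close>
    let ?y = "pt (\<one>, Suc (lev x) mod 4)" and ?z = "pt (\<one>, (lev x + 3) mod 4)"
    have "lev (\<sigma> x) = lev x \<or> lev (\<sigma> x) = Suc (lev x) mod 4"
      using step[of x ?y] x by auto
    moreover have "Suc ((lev x + 3) mod 4) mod 4 = lev x"
      using mod4_cases[OF lev_S[OF x]] by auto
    then have "lev (\<sigma> x) = (lev x + 3) mod 4 \<or> lev (\<sigma> x) = lev x"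
      using step[of ?z x] x by auto
    ultimately show ?thesis using mod4_cases[OF lev_S[OF x]] by auto
  qed
  define a where "a x = grp (\<sigma> x) \<otimes> inv (grp x)" for x
  have a_S: "a x \<in> carrier H" if "x \<in> S" for x using that \<sigma> grp_S by (simp add: a_def)
  have a_step: "a y = a x" if x: "x \<in> S" and y: "y \<in> S" and l: "lev y = Suc (lev x) mod 4" for x y
  proof -
    have g: "grp x \<in> carrier H" "grp y \<in> carrier H" "grp (\<sigma> x) \<in> carrier H" "grp (\<sigma> y) \<in> carrier H"
      using x y \<sigma> grp_S by auto
    have "inv (grp x) \<otimes> grp y = inv (grp (\<sigma> x)) \<otimes> grp (\<sigma> y)"
      using step[OF x y l] lev\<sigma>[OF x] mod4_cases[OF lev_S[OF x]] by auto
    then have "grp (\<sigma> x) \<otimes> (inv (grp x) \<otimes> grp y) \<otimes> inv (grp y) =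
        grp (\<sigma> x) \<otimes> (inv (grp (\<sigma> x)) \<otimes> grp (\<sigma> y)) \<otimes> inv (grp y)" by simp
    then show ?thesis using g by (simp add: a_def m_assoc) (simp add: m_assoc[symmetric])
  qed
  define h where "h = a (pt (\<one>, 0))"
  have h0: "a (pt (\<one>, 0)) = h" by (simp add: h_def)
  have h1: "a (pt (\<one>, 1)) = h" using a_step[of "pt (\<one>, 0)" "pt (\<one>, 1)"] h0 by simp
  have h2: "a (pt (\<one>, 2)) = h" using a_step[of "pt (\<one>, 1)" "pt (\<one>, 2)"] h1 by simp
  have h3: "a (pt (\<one>, 3)) = h" using a_step[of "pt (\<one>, 2)" "pt (\<one>, 3)"] h2 by simp
  have a_h: "a x = h" if x: "x \<in> S" for x
    using mod4_cases[OF lev_S[OF x]] h0 h1 h2 h3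
      a_step[of "pt (\<one>, 0)" x] a_step[of "pt (\<one>, 1)" x] a_step[of "pt (\<one>, 2)" x] a_step[of "pt (\<one>, 3)" x] x
    by auto
  have h: "h \<in> carrier H" using a_S[of "pt (\<one>, 0)"] by (simp add: h_def)
  have "\<sigma> = trans h"
  proof (rule extensionalityI[of _ S])
    show "\<sigma> \<in> extensional S" using assms(1) by (rule Bij_imp_extensional)
    show "trans h \<in> extensional S" by (simp add: trans_def)
    fix x assume x: "x \<in> S"
    have "h \<otimes> grp x = grp (\<sigma> x)"
      using a_h[OF x] grp_S[OF x] grp_S[OF \<sigma>[OF x]] by (auto simp: a_def m_assoc)
    then show "\<sigma> x = trans h x"
      using trans_S[OF h x] \<sigma>[OF x] lev\<sigma>[OF x] by (intro S_eqI) auto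
  qed
  then show ?thesis using h by blast
qed

lemma iso_symmetries: "H \<cong> isometry_group S e"
proof -
  have carr: "carrier (isometry_group S e) = {f \<in> Bij S. \<forall>x\<in>S. \<forall>y\<in>S. e (f x) (f y) = e x y}"
    by (simp add: isometry_group_def)
  have "trans \<in> iso H (isometry_group S e)"
  proof (rule isoI)
    show "trans \<in> hom H (isometry_group S e)"
    proof (rule homI)
      show "trans h \<in> carrier (isometry_group S e)" if "h \<in> carrier H" for h
        unfolding carr using that by (simp add: trans_Bij trans_e)
      show "trans (g \<otimes> h) = trans g \<otimes>\<^bsub>isometry_group S e\<^esub> trans h"
        if "g \<in> carrier H" "h \<in> carrier H" for g h
        unfolding trans_compose[OF that] using that
        by (simp add: isometry_group_def BijGroup_def trans_Bij)
    qed
    have "inj_on trans (carrier H)"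
    proof (rule inj_onI)
      fix g h assume "g \<in> carrier H" "h \<in> carrier H" "trans g = trans h"
      then show "g = h"
        using trans_S[of _ "pt (\<one>, 0)"] by (metis grp_pt one_closed pt_S r_one zero_less_numeral)
    qed
    moreover have "trans ` carrier H = carrier (isometry_group S e)"
      unfolding carr using trans_Bij trans_e aut_is_trans by blast
    ultimately show "bij_betw trans (carrier H) (carrier (isometry_group S e))"
      by (simp add: bij_betw_def)
  qed
  then show ?thesis unfolding is_iso_def by blast
qed

end

theorem corollary7:
  fixes H :: "('h, 'm) monoid_scheme" and p :: real
  assumes "group H" and "countable (carrier H)" and "p \<ge> 1"
  shows "\<exists>X :: real metric.
    mspace X \<noteq> {} \<and> mcomplete_of X \<and> separable_space (mtopology_of X) \<and>
    isometry_group (wasserstein_space p X) (wasserstein_dist p X) \<cong> H"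
proof -
  interpret H: group H by (rule assms(1))
  have "countable (carrier H \<times> {..<4::nat})"
    using assms(2) by (intro countable_SIGMA) auto
  then obtain code :: "'h \<times> nat \<Rightarrow> nat" where "inj_on code (carrier H \<times> {..<4})"
    unfolding countable_def by blast
  then interpret C: layered_cayley H code by unfold_locales
  interpret N: near_uniform_space C.S C.e p by (rule C.near_uniform[OF assms(3)])
  have "isometry_group (wasserstein_space p N.X) (wasserstein_dist p N.X) \<cong> H"
    using iso_trans[OF C.iso_symmetries N.wasserstein_rigidity] by (rule H.iso_sym)
  then show ?thesis
    using N.S_ne N.mcomplete_X N.separable_X by (intro exI[of _ N.X]) simp
qed

end
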